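(* Let $n\geq 3$ be an integer and let $G$ be a connected graph of order $n$. (1) If ($n \geq 9$ or $n=3$ or $n=7$), $e(G)\geq \binom{n-1}{2}+1$ and $G \neq K_1 \vee (K_{n-2}+K_1)$, then $G-v$ has a $\{K_2,\{C_t : t\geq 3\}\}$-factor for every $v\in V(G)$. (2) If $n\in\{4,6\}$, $e(G)\geq \frac{3n^2-2n}{8}$ and $G \neq K_{\frac{n}{2}} \vee \frac{n}{2}K_1$, then $G-v$ has a $\{K_2,\{C_t : t\geq 3\}\}$-factor for every $v\in V(G)$. (3) If $n=5$ and $e(G)\geq 7$, then $G-v$ has a $\{K_2,\{C_t : t\geq 3\}\}$-factor for every $v\in V(G)$ unless $G = K_2 \vee 3K_1$ or $G = K_1 \vee (K_3+K_1)$. (4) If $n=8$ and $e(G)\geq 22$, then $G-v$ has a $\{K_2,\{C_t : t\geq 3\}\}$-factor for every $v\in V(G)$ unless $G = K_4 \vee 4K_1$ or $G = K_1 \vee (K_6+K_1)$.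
   Context: All graphs are finite, simple and undirected. The order of $G$ is its number of vertices and $e(G)$ is its number of edges; $G-v$ is $G$ with the vertex $v$ and its incident edges deleted. $K_m$ is the complete graph on $m$ vertices, $C_t$ the cycle on $t$ vertices, $G_1+G_2$ is the (vertex-disjoint) union, $mK_1$ is the graph consisting of $m$ isolated vertices, and the join $G_1\vee G_2$ is obtained from vertex-disjoint $G_1,G_2$ by adding all edges between $V(G_1)$ and $V(G_2)$. Equality of graphs means isomorphism. A $\{K_2,\{C_t : t\geq 3\}\}$-factor of a graph $H$ is a spanning subgraph of $H$ each of whose connected components is isomorphic to $K_2$ or to a cycle $C_t$ with $t\geq 3$. *)

theory Defs
  imports Complex_Main
begin

record 'a graph =
  verts :: "'a set"
  edges :: "'a set set"

definition simple_graph :: "'a graph \<Rightarrow> bool" where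
  "simple_graph G \<longleftrightarrow>
     finite (verts G) \<and> (\<forall>e\<in>edges G. e \<subseteq> verts G \<and> card e = 2)"

definition graph_order :: "'a graph \<Rightarrow> nat" where
  "graph_order G = card (verts G)"

definition graph_size :: "'a graph \<Rightarrow> nat" where
  "graph_size G = card (edges G)"

definition graph_iso :: "'a graph \<Rightarrow> 'b graph \<Rightarrow> bool"  (infix "\<simeq>\<^sub>G" 50) where
  "G \<simeq>\<^sub>G H \<longleftrightarrow>
     (\<exists>f. bij_betw f (verts G) (verts H) \<and>
          (\<forall>u\<in>verts G. \<forall>v\<in>verts G. {u, v} \<in> edges G \<longleftrightarrow> {f u, f v} \<in> edges H))"

definition complete_graph :: "nat \<Rightarrow> nat graph" where
  "complete_graph m = \<lparr>verts = {..<m}, edges = {e. e \<subseteq> {..<m} \<and> card e = 2}\<rparr>"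

definition empty_graph :: "nat \<Rightarrow> nat graph" where
  "empty_graph m = \<lparr>verts = {..<m}, edges = {}\<rparr>"

text \<open>Only meaningful for \<open>t \<ge> 3\<close>; smaller values do not give a cycle.\<close>

definition cycle_graph :: "nat \<Rightarrow> nat graph" where
  "cycle_graph t = \<lparr>verts = {..<t}, edges = (\<lambda>i. {i, Suc i mod t}) ` {..<t}\<rparr>"

definition graph_union :: "'a graph \<Rightarrow> 'b graph \<Rightarrow> ('a + 'b) graph"  (infixr "+\<^sub>G" 65) where
  "G +\<^sub>G H =
     \<lparr>verts = verts G <+> verts H,
      edges = (image Inl) ` edges G \<union> (image Inr) ` edges H\<rparr>"

definition graph_join :: "'a graph \<Rightarrow> 'b graph \<Rightarrow> ('a + 'b) graph"  (infixr "\<or>\<^sub>G" 60) where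
  "G \<or>\<^sub>G H =
     \<lparr>verts = verts (G +\<^sub>G H),
      edges = edges (G +\<^sub>G H) \<union> {{Inl u, Inr w} | u w. u \<in> verts G \<and> w \<in> verts H}\<rparr>"

definition induced_subgraph :: "'a graph \<Rightarrow> 'a set \<Rightarrow> 'a graph" where
  "induced_subgraph G S = \<lparr>verts = verts G \<inter> S, edges = {e \<in> edges G. e \<subseteq> S}\<rparr>"

definition delete_vertex :: "'a graph \<Rightarrow> 'a \<Rightarrow> 'a graph" where
  "delete_vertex G v = induced_subgraph G (verts G - {v})"

definition reachable :: "'a graph \<Rightarrow> 'a \<Rightarrow> 'a \<Rightarrow> bool" where
  "reachable G u v \<longleftrightarrow> (u, v) \<in> {(x, y). {x, y} \<in> edges G}\<^sup>*"

definition connected_graph :: "'a graph \<Rightarrow> bool" where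
  "connected_graph G \<longleftrightarrow>
     verts G \<noteq> {} \<and> (\<forall>u\<in>verts G. \<forall>v\<in>verts G. reachable G u v)"

definition components :: "'a graph \<Rightarrow> 'a graph set" where
  "components G = (\<lambda>v. induced_subgraph G {u. reachable G v u}) ` verts G"

definition spanning_subgraph :: "'a graph \<Rightarrow> 'a graph \<Rightarrow> bool" where
  "spanning_subgraph F H \<longleftrightarrow> verts F = verts H \<and> edges F \<subseteq> edges H"

definition has_K2_cycle_factor :: "'a graph \<Rightarrow> bool" where
  "has_K2_cycle_factor H \<longleftrightarrow>
     (\<exists>F. spanning_subgraph F H \<and>
          (\<forall>C\<in>components F.
             C \<simeq>\<^sub>G complete_graph 2 \<or> (\<exists>t\<ge>3. C \<simeq>\<^sub>G cycle_graph t)))"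

end

theory Submission
  imports Defs
begin

text \<open>
  By Hall's theorem applied to the neighbourhoods of the vertices of \<open>H = G - v\<close>, either
  some injection \<open>f\<close> sends each vertex to one of its neighbours, or \<open>H\<close> has an independent set
  with fewer neighbours than elements. In the first case \<open>f\<close> is a fixed-point-free permutation
  and the edges \<open>{x, f x}\<close> form the factor: its components are the cycles of \<open>f\<close>. In the second
  case, adding \<open>v\<close> to the neighbours and shrinking the independent set gives \<open>s\<close> independent
  vertices of \<open>G\<close> whose neighbours lie in a set of size \<open>s\<close>. Then \<open>G\<close> has at most
  \<open>(n - s choose 2) + s\<^sup>2\<close> edges, with equality only for the join of \<open>K\<^sub>s\<close> with
  \<open>K\<^bsub>n-2s\<^esub> + sK\<^sub>1\<close>; this bound is convex in \<open>s\<close>, hence maximal at an end of its range.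
\<close>

section \<open>Hall's marriage theorem\<close>

lemma hall_marriage:
  fixes A :: "'i \<Rightarrow> 'a set"
  assumes "finite I" and "\<And>i. i \<in> I \<Longrightarrow> finite (A i)"
    and "\<And>J. J \<subseteq> I \<Longrightarrow> card J \<le> card (\<Union>(A ` J))"
  shows "\<exists>f. inj_on f I \<and> (\<forall>i\<in>I. f i \<in> A i)"
  using assms
proof (induction "card I" arbitrary: I A rule: less_induct)
  case less
  show ?case
  \<comment> \<open>Halmos-Vaughan induction. If a nonempty proper subfamily \<open>J\<close> is
    tight, it and the remaining indices are matched separately. Otherwise every such subfamily has
    an element to spare, and one choice can be made freely.\<close>
  proof (cases "\<exists>J. J \<subset> I \<and> J \<noteq> {} \<and> card (\<Union>(A ` J)) = card J")
    case True
    then obtain J where J: "J \<subset> I" "J \<noteq> {}" and tight: "card (\<Union>(A ` J)) = card J"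
      by blast
    define U where "U = \<Union>(A ` J)"
    have fin: "finite J" "finite (I - J)" "finite U"
    proof -
      show J': "finite J" "finite (I - J)"
        using J less.prems(1) by (auto intro: finite_subset)
      show "finite U"
        unfolding U_def using J' J less.prems(2) by blast
    qed
    have "card J < card I"
      using J less.prems(1) by (simp add: psubset_card_mono)
    moreover have "finite (A i)" if "i \<in> J" for i
      using J less.prems(2) that by blast
    moreover have "card K \<le> card (\<Union>(A ` K))" if "K \<subseteq> J" for K
      using J less.prems(3)[of K] that by blast
    ultimately obtain g where g: "inj_on g J" "\<forall>i\<in>J. g i \<in> A i"
      using less.hyps[of J A] fin by blast
    have "card (I - J) < card I"
      using J less.prems(1) by (intro psubset_card_mono) auto
    moreover have "finite (A i - U)" if "i \<in> I - J" for i
      using less.prems(2) that by blast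
    \<comment> \<open>The elements of \<open>U\<close> are reserved for \<open>J\<close>. Hall's
      condition for \<open>K \<union> J\<close>, less the equal cardinalities of \<open>U\<close>
      and \<open>J\<close>, is Hall's condition for the reduced sets.\<close>
    moreover have "card K \<le> card (\<Union>i\<in>K. A i - U)" if K: "K \<subseteq> I - J" for K
    proof -
      have finK: "finite K" "finite (\<Union>i\<in>K. A i - U)"
        using K fin less.prems(2) by (auto intro: finite_subset)
      have "card K + card J = card (K \<union> J)"
        using K finK fin by (subst card_Un_disjoint) auto
      also have "\<dots> \<le> card (\<Union>(A ` (K \<union> J)))"
        using K J by (intro less.prems(3)) auto
      also have "\<Union>(A ` (K \<union> J)) = (\<Union>i\<in>K. A i - U) \<union> U"
        by (auto simp: U_def)
      also have "card \<dots> = card (\<Union>i\<in>K. A i - U) + card J"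
        using finK fin tight by (subst card_Un_disjoint) (auto simp: U_def)
      finally show ?thesis by simp
    qed
    ultimately obtain h where h: "inj_on h (I - J)" "\<forall>i\<in>I - J. h i \<in> A i - U"
      using less.hyps[of "I - J" "\<lambda>i. A i - U"] fin by blast
    have "inj_on (\<lambda>i. if i \<in> J then g i else h i) I"
      using g h unfolding inj_on_def U_def by (smt (verit) DiffD2 DiffI UN_I)
    then show ?thesis
      using g h by (intro exI[of _ "\<lambda>i. if i \<in> J then g i else h i"]) auto
  next
    case False
    show ?thesis
    proof (cases "I = {}")
      case nonempty: False
      then obtain i where i: "i \<in> I" by blast
      have "A i \<noteq> {}"
        using less.prems(3)[of "{i}"] i by auto
      then obtain x where x: "x \<in> A i" by blast
      have "card (I - {i}) < card I"
        using i less.prems(1) by (rule card_Diff1_less[rotated])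
      moreover have "card K \<le> card (\<Union>j\<in>K. A j - {x})" if K: "K \<subseteq> I - {i}" for K
      proof (cases "K = {}")
        case False
        \<comment> \<open>Here \<open>K\<close> is nonempty, proper and not tight, so the inequality
          is strict and its surplus pays for the removal of \<open>x\<close>.\<close>
        have "card K < card (\<Union>(A ` K))"
          using \<open>\<nexists>J. _\<close> K i False less.prems(3)[of K] by (metis Diff_iff insertI1 le_neq_implies_less psubsetI subset_Diff_insert subset_iff)
        moreover have "(\<Union>j\<in>K. A j - {x}) = \<Union>(A ` K) - {x}" by auto
        moreover have "card (\<Union>(A ` K)) - 1 \<le> card (\<Union>(A ` K) - {x})"
          by (simp add: card_Diff_singleton_if)
        ultimately show ?thesis by simp
      qed simp
      ultimately obtain h where h: "inj_on h (I - {i})" "\<forall>j\<in>I - {i}. h j \<in> A j - {x}"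
        using less.hyps[of "I - {i}" "\<lambda>j. A j - {x}"] less.prems(1,2) by blast
      have "inj_on (h(i := x)) I"
        using h unfolding inj_on_def by auto
      then show ?thesis
        using h x by (intro exI[of _ "h(i := x)"]) auto
    qed simp
  qed
qed

section \<open>Permutations without fixed points and their cycles\<close>

text \<open>For t = 2 the two edges in the definition coincide. Hence a pair swapped by a
  permutation, which must yield a K_2, needs no separate treatment in the analysis of
  orbits.\<close>

lemma cycle_graph_2: "cycle_graph 2 = complete_graph 2"
proof -
  have two: "{..<2} = {0, 1 :: nat}" by auto
  have "e = {0, 1}" if "e \<subseteq> {..<2}" "card e = 2" for e :: "nat set"
    using card_subset_eq[of "{..<2}" e] that two by simp
  then have "{e. e \<subseteq> {..<2} \<and> card e = 2} \<subseteq> {{0, 1 :: nat}}"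
    by blast
  then have "{e. e \<subseteq> {..<2} \<and> card e = 2} = {{0, 1 :: nat}}"
    by (rule equalityI) simp
  moreover have "(\<lambda>i. {i, Suc i mod 2}) ` {..<2} = {{0, 1}}"
    unfolding two by auto
  ultimately show ?thesis
    by (simp add: cycle_graph_def complete_graph_def)
qed

lemma graph_iso_sym:
  assumes "G \<simeq>\<^sub>G H"
  shows "H \<simeq>\<^sub>G G"
proof -
  obtain f where f: "bij_betw f (verts G) (verts H)"
    and edge: "\<And>u v. u \<in> verts G \<Longrightarrow> v \<in> verts G \<Longrightarrow> {u, v} \<in> edges G \<longleftrightarrow> {f u, f v} \<in> edges H"
    using assms unfolding graph_iso_def by blast
  let ?g = "inv_into (verts G) f"
  have "bij_betw ?g (verts H) (verts G)"
    using f by (rule bij_betw_inv_into)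
  moreover have "{u, v} \<in> edges H \<longleftrightarrow> {?g u, ?g v} \<in> edges G" if "u \<in> verts H" "v \<in> verts H" for u v
    using edge[of "?g u" "?g v"] that f
      bij_betw_apply[OF bij_betw_inv_into[OF f]] bij_betw_inv_into_right[OF f] by simp
  ultimately show ?thesis
    unfolding graph_iso_def by blast
qed

definition perm_graph :: "'a set \<Rightarrow> ('a \<Rightarrow> 'a) \<Rightarrow> 'a graph" where
  "perm_graph V f = \<lparr>verts = V, edges = (\<lambda>x. {x, f x}) ` V\<rparr>"

text \<open>The component of \<open>v\<close> is its orbit, which the iterates of \<open>f\<close>
  number cyclically. The period is at least 2 because \<open>f\<close> fixes no vertex.\<close>

lemma component_perm_graph:
  assumes "finite V" and f: "bij_betw f V V" and v: "v \<in> V" and nofix: "\<And>x. x \<in> V \<Longrightarrow> f x \<noteq> x"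
  shows "\<exists>t\<ge>2. induced_subgraph (perm_graph V f) {u. reachable (perm_graph V f) v u} \<simeq>\<^sub>G cycle_graph t"
proof -
  define F where "F = perm_graph V f"
  have fV: "f x \<in> V" if "x \<in> V" for x
    using f that by (meson bij_betwE)
  have powV: "(f ^^ k) v \<in> V" for k
    by (induction k) (auto simp: v fV)
  have inj: "x = y" if "f x = f y" "x \<in> V" "y \<in> V" for x y
    using f that by (auto simp: bij_betw_def inj_on_def)
  \<comment> \<open>Injectivity lets equal applications of \<open>f\<close> be peeled off both
    sides, so any repetition among the iterates is a return to \<open>v\<close> itself.\<close>
  have cancel: "(f ^^ (j - i)) v = v" if "i \<le> j" "(f ^^ i) v = (f ^^ j) v" for i j
    using that
  proof (induction i arbitrary: j)
    case (Suc i)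
    then obtain j' where j': "j = Suc j'" by (cases j) auto
    then have "(f ^^ i) v = (f ^^ j') v"
      using Suc.prems inj powV by auto
    then show ?case
      using Suc j' by auto
  qed simp
  have "\<not> inj (\<lambda>k. (f ^^ k) v)"
  proof
    assume "inj (\<lambda>k. (f ^^ k) v)"
    moreover have "range (\<lambda>k. (f ^^ k) v) \<subseteq> V"
      using powV by blast
    ultimately show False
      using \<open>finite V\<close> finite_subset finite_imageD by blast
  qed
  then obtain i j where "i < j" "(f ^^ i) v = (f ^^ j) v"
    unfolding inj_def by (metis (no_types) linorder_neqE_nat)
  then have ex: "\<exists>t>0. (f ^^ t) v = v"
    using cancel[of i j] by (intro exI[of _ "j - i"]) auto
  \<comment> \<open>The period of \<open>v\<close>. Minimality makes the first \<open>t\<close>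
    iterates distinct, and exponents matter only modulo \<open>t\<close>.\<close>
  define t where "t = (LEAST t. t > 0 \<and> (f ^^ t) v = v)"
  have t: "t > 0" "(f ^^ t) v = v"
    using LeastI_ex[OF ex] unfolding t_def by auto
  have tmin: "k = 0" if "k < t" "(f ^^ k) v = v" for k
    using not_less_Least[of k "\<lambda>t. t > 0 \<and> (f ^^ t) v = v"] that unfolding t_def by auto
  have "t \<noteq> 1"
    using t nofix[OF v] by auto
  then have "t \<ge> 2" using t by simp
  have powmod: "(f ^^ (k mod t)) v = (f ^^ k) v" for k
  proof -
    have "(f ^^ (m * t)) v = v" for m
      by (induction m) (simp_all add: funpow_add t)
    then have "(f ^^ (k mod t + k div t * t)) v = (f ^^ (k mod t)) v"
      by (simp only: funpow_add comp_apply)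
    then show ?thesis
      by (simp add: add.commute)
  qed
  have pinj: "i = j" if "i < t" "j < t" "(f ^^ i) v = (f ^^ j) v" for i j
  proof (cases "i \<le> j")
    case True
    then have "j - i = 0"
      using cancel[of i j] that by (intro tmin) auto
    then show ?thesis using True by simp
  next
    case False
    then have "i - j = 0"
      using cancel[of j i] that by (intro tmin) auto
    then show ?thesis using False by simp
  qed
  define orb where "orb = (\<lambda>k. (f ^^ k) v) ` {..<t}"
  have orb_all: "(f ^^ k) v \<in> orb" for k
    unfolding orb_def using t by (intro image_eqI[of _ _ "k mod t"]) (simp_all add: powmod)
  have edge_F: "{x, y} \<in> edges F \<longleftrightarrow> x \<in> V \<and> y = f x \<or> y \<in> V \<and> x = f y" for x y
    by (auto simp: F_def perm_graph_def doubleton_eq_iff)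
  have step: "y \<in> orb" if xy: "x \<in> orb" "{x, y} \<in> edges F" for x y
  proof -
    obtain k where k: "x = (f ^^ k) v" "k < t"
      using xy by (auto simp: orb_def)
    show ?thesis
    proof (cases "y = f x")
      case True
      then show ?thesis using orb_all[of "Suc k"] k by simp
    next
      case False
      then have "y \<in> V" "x = f y" using xy edge_F by auto
      \<comment> \<open>Edges can also be traversed against \<open>f\<close>, so the predecessor of
        \<open>x\<close> must lie in the orbit. Adding \<open>t\<close> before subtracting 1 covers
        the case k = 0.\<close>
      moreover have "x = f ((f ^^ (k + t - 1)) v)"
      proof -
        have "f ((f ^^ (k + t - 1)) v) = (f ^^ (k + t)) v"
          using t(1) by (cases t) auto
        also have "\<dots> = x"
          by (simp only: funpow_add comp_apply t k)
        finally show ?thesis ..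
      qed
      ultimately show ?thesis using inj powV orb_all by metis
    qed
  qed
  have reach: "{u. reachable F v u} = orb"
  proof (intro set_eqI iffI)
    fix u assume "u \<in> {u. reachable F v u}"
    then have "(v, u) \<in> {(x, y). {x, y} \<in> edges F}\<^sup>*" by (simp add: reachable_def)
    then show "u \<in> orb"
      by induction (use step orb_all[of 0] in auto)
  next
    fix u assume "u \<in> orb"
    then obtain k where u: "u = (f ^^ k) v" by (auto simp: orb_def)
    have "(v, (f ^^ k) v) \<in> {(x, y). {x, y} \<in> edges F}\<^sup>*" for k
    proof (induction k)
      case (Suc k)
      have "{(f ^^ k) v, (f ^^ Suc k) v} \<in> edges F"
        using powV by (simp add: edge_F)
      then show ?case using Suc by (auto intro: rtrancl_into_rtrancl)
    qed simp
    then show "u \<in> {u. reachable F v u}" by (simp add: u reachable_def)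
  qed
  have "cycle_graph t \<simeq>\<^sub>G induced_subgraph F orb"
    unfolding graph_iso_def
  proof (intro exI conjI ballI)
    have "orb \<subseteq> V" using powV by (auto simp: orb_def)
    then show "bij_betw (\<lambda>k. (f ^^ k) v) (verts (cycle_graph t)) (verts (induced_subgraph F orb))"
      using pinj
      by (auto simp: bij_betw_def inj_on_def cycle_graph_def induced_subgraph_def F_def perm_graph_def orb_def)
    fix i j assume "i \<in> verts (cycle_graph t)" "j \<in> verts (cycle_graph t)"
    then have ij: "i < t" "j < t" by (auto simp: cycle_graph_def)
    \<comment> \<open>Being the image under \<open>f\<close> becomes the cyclic successor on
      exponents, which is how \<open>cycle_graph\<close> describes its edges.\<close>
    have succ: "(f ^^ b) v = f ((f ^^ a) v) \<longleftrightarrow> b = Suc a mod t" if "a < t" "b < t" for a b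
      using pinj[of b "Suc a mod t"] powmod[of "Suc a"] that t by auto
    have "{i, j} \<in> edges (cycle_graph t) \<longleftrightarrow> j = Suc i mod t \<or> i = Suc j mod t"
      using ij by (auto simp: cycle_graph_def doubleton_eq_iff)
    also have "\<dots> \<longleftrightarrow> {(f ^^ i) v, (f ^^ j) v} \<in> edges F"
      using succ ij powV by (auto simp: edge_F)
    also have "\<dots> \<longleftrightarrow> {(f ^^ i) v, (f ^^ j) v} \<in> edges (induced_subgraph F orb)"
      using orb_all by (auto simp: induced_subgraph_def)
    finally show "{i, j} \<in> edges (cycle_graph t) \<longleftrightarrow> {(f ^^ i) v, (f ^^ j) v} \<in> edges (induced_subgraph F orb)" .
  qed
  then show ?thesis
    using graph_iso_sym \<open>t \<ge> 2\<close> reach F_def by metis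
qed

text \<open>Neighbours are again vertices, so the injection is a permutation of a finite set; edges
  have two ends, so it has no fixed point. Its orbits of size 2 give the K_2 components, the larger
  ones the cycles.\<close>

lemma neighbour_injection_imp_factor:
  assumes "simple_graph H" and f: "inj_on f (verts H)" "\<And>x. x \<in> verts H \<Longrightarrow> {x, f x} \<in> edges H"
  shows "has_K2_cycle_factor H"
proof -
  let ?F = "perm_graph (verts H) f"
  have "finite (verts H)" and edge: "\<And>e. e \<in> edges H \<Longrightarrow> e \<subseteq> verts H \<and> card e = 2"
    using assms(1) by (auto simp: simple_graph_def)
  moreover have "f ` verts H \<subseteq> verts H"
    using edge f by blast
  ultimately have bij: "bij_betw f (verts H) (verts H)"
    using f(1) endo_inj_surj[of "verts H" f] by (simp add: bij_betw_def)
  have nofix: "f x \<noteq> x" if "x \<in> verts H" for x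
    using edge[OF f(2)[OF that]] by auto
  have "C \<simeq>\<^sub>G complete_graph 2 \<or> (\<exists>t\<ge>3. C \<simeq>\<^sub>G cycle_graph t)" if C: "C \<in> components ?F" for C
  proof -
    obtain t where "t \<ge> 2" "C \<simeq>\<^sub>G cycle_graph t"
      using C component_perm_graph[OF \<open>finite (verts H)\<close> bij _ nofix]
      by (auto simp: components_def perm_graph_def)
    then show ?thesis
      using cycle_graph_2 by (cases "t = 2") force+
  qed
  moreover have "spanning_subgraph ?F H"
    using f by (auto simp: spanning_subgraph_def perm_graph_def)
  ultimately show ?thesis
    unfolding has_K2_cycle_factor_def by blast
qed

section \<open>Independent sets with few neighbours and the edges they allow\<close>

lemma no_factor_imp_independent_set:
  assumes "simple_graph H" "\<not> has_K2_cycle_factor H"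
  shows "\<exists>I S. I \<subseteq> verts H \<and> S \<subseteq> verts H - I \<and> card S < card I \<and>
    (\<forall>x\<in>I. \<forall>y. {x, y} \<in> edges H \<longrightarrow> y \<in> S)"
proof -
  define N where "N T = (\<Union>x\<in>T. {y. {x, y} \<in> edges H})" for T
  have fin: "finite (verts H)" and NV: "\<And>T. N T \<subseteq> verts H"
    using assms(1) by (auto simp: simple_graph_def N_def)
  have finV: "finite X" if "X \<subseteq> verts H" for X
    using that fin by (rule finite_subset)
  have "\<exists>T\<subseteq>verts H. card (N T) < card T"
  proof (rule ccontr)
    assume *: "\<not> ?thesis"
    have "\<exists>f. inj_on f (verts H) \<and> (\<forall>x\<in>verts H. f x \<in> {y. {x, y} \<in> edges H})"
    proof (rule hall_marriage)
      show "finite {y. {x, y} \<in> edges H}" for x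
        using assms(1) by (intro finV) (auto simp: simple_graph_def)
      show "card J \<le> card (\<Union>x\<in>J. {y. {x, y} \<in> edges H})" if "J \<subseteq> verts H" for J
        using * that by (auto simp: N_def not_less)
    qed fact
    then show False
      using assms neighbour_injection_imp_factor by blast
  qed
  then obtain T where T: "T \<subseteq> verts H" "card (N T) < card T" by blast
  \<comment> \<open>The set \<open>T\<close> violating Hall's condition need not be independent.
    Discarding the vertices of \<open>T\<close> that have a neighbour in \<open>T\<close> makes it
    so.\<close>
  define I where "I = T - N T"
  have finT: "finite T" "finite (N T)"
    using T NV finV by auto
  \<comment> \<open>A neighbour in \<open>T\<close> of a vertex of \<open>I\<close> would put that
    vertex into \<open>N T\<close>. So both \<open>T\<close> and its neighbourhood lose the common
    part \<open>N T \<inter> T\<close>, and the deficiency survives.\<close>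
  have NI: "N I \<subseteq> N T - T"
    by (auto simp: I_def N_def insert_commute)
  have "card (N T - T) + card (N T \<inter> T) = card (N T)"
    using card_Int_Diff[of "N T" T] finT by simp
  moreover have "card I + card (N T \<inter> T) = card T"
    using card_Int_Diff[of T "N T"] finT by (simp add: I_def Int_commute)
  moreover have "card (N I) \<le> card (N T - T)"
    using NI finT by (intro card_mono) auto
  ultimately have "card (N I) < card I"
    using T by linarith
  moreover have "N I \<subseteq> verts H - I"
    using NV NI by (auto simp: I_def)
  ultimately show ?thesis
    using T by (intro exI[of _ I] exI[of _ "N I"]) (auto simp: I_def N_def)
qed

text \<open>An edge either avoids \<open>I\<close> or joins \<open>I\<close> to \<open>S\<close>;
  these are the families \<open>P\<close> and \<open>Q\<close>. If the count is attained, every pair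
  in either family is an edge, so adjacency is completely determined.\<close>

lemma independent_set_edges:
  assumes "simple_graph G" and I: "I \<subseteq> verts G" and S: "S \<subseteq> verts G - I" and "card I = s" "card S = s"
    and nbr: "\<forall>x\<in>I. \<forall>y. {x, y} \<in> edges G \<longrightarrow> y \<in> S"
  shows "graph_size G \<le> ((graph_order G - s) choose 2) + s ^ 2"
    and "graph_size G = ((graph_order G - s) choose 2) + s ^ 2 \<Longrightarrow> u \<in> verts G \<Longrightarrow> w \<in> verts G \<Longrightarrow>
      {u, w} \<in> edges G \<longleftrightarrow> u \<noteq> w \<and> (u \<in> I \<longrightarrow> w \<in> S) \<and> (w \<in> I \<longrightarrow> u \<in> S)"
proof -
  define P where "P = {e. e \<subseteq> verts G - I \<and> card e = 2}"
  define Q where "Q = (\<lambda>(x, y). {x, y}) ` (I \<times> S)"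
  have fin: "finite (verts G)" and edge: "\<And>e. e \<in> edges G \<Longrightarrow> e \<subseteq> verts G \<and> card e = 2"
    using assms(1) by (auto simp: simple_graph_def)
  have finIS: "finite I" "finite S"
    using fin I S by (auto intro: finite_subset)
  have sub: "edges G \<subseteq> P \<union> Q"
  proof
    fix e assume e: "e \<in> edges G"
    show "e \<in> P \<union> Q"
    proof (cases "e \<inter> I = {}")
      case True
      then show ?thesis using edge[OF e] by (auto simp: P_def)
    next
      case False
      then obtain x where x: "x \<in> e" "x \<in> I" by blast
      then obtain y where y: "e = {x, y}"
        using edge[OF e] by (auto simp: card_2_iff)
      then have "y \<in> S" using nbr x e by blast
      then show ?thesis using x y by (auto simp: Q_def)
    qed
  qed
  have finPQ: "finite (P \<union> Q)"
    using fin finIS by (auto simp: P_def Q_def)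
  have "card P = ((graph_order G - s) choose 2)"
    using fin finIS I assms(4) by (simp add: P_def n_subsets graph_order_def card_Diff_subset)
  moreover have "card Q \<le> s ^ 2"
    using card_image_le[of "I \<times> S" "\<lambda>(x, y). {x, y}"] finIS assms(4,5)
    by (simp add: Q_def card_cartesian_product power2_eq_square)
  ultimately have card_PQ: "card (P \<union> Q) \<le> ((graph_order G - s) choose 2) + s ^ 2"
    using card_Un_le[of P Q] by linarith
  then show "graph_size G \<le> ((graph_order G - s) choose 2) + s ^ 2"
    using card_mono[OF finPQ sub] by (simp add: graph_size_def)
  assume eq: "graph_size G = ((graph_order G - s) choose 2) + s ^ 2" and uw: "u \<in> verts G" "w \<in> verts G"
  have "edges G = P \<union> Q"
    using card_seteq[OF finPQ sub] card_PQ eq by (simp add: graph_size_def)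
  moreover have "{u, w} \<in> Q \<longleftrightarrow> u \<in> I \<and> w \<in> S \<or> w \<in> I \<and> u \<in> S"
    by (auto simp: Q_def doubleton_eq_iff)
  moreover have "{u, w} \<in> P \<longleftrightarrow> u \<noteq> w \<and> u \<notin> I \<and> w \<notin> I"
    using uw by (auto simp: P_def card_2_iff doubleton_eq_iff)
  ultimately show "{u, w} \<in> edges G \<longleftrightarrow> u \<noteq> w \<and> (u \<in> I \<longrightarrow> w \<in> S) \<and> (w \<in> I \<longrightarrow> u \<in> S)"
    using S by blast
qed

section \<open>Recognising complete and empty graphs, unions and joins\<close>

lemma induced_complete_iso:
  assumes "A \<subseteq> verts G" "finite A" "card A = m"
    and "\<And>u v. u \<in> A \<Longrightarrow> v \<in> A \<Longrightarrow> {u, v} \<in> edges G \<longleftrightarrow> u \<noteq> v"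
  shows "induced_subgraph G A \<simeq>\<^sub>G complete_graph m"
proof -
  obtain f where f: "bij_betw f A {..<m}"
    using assms(2,3) ex_bij_betw_finite_nat[of A] by (auto simp: atLeast0LessThan)
  have "{u, v} \<in> edges G \<longleftrightarrow> f u < m \<and> f v < m \<and> card {f u, f v} = 2" if "u \<in> A" "v \<in> A" for u v
    using assms(4)[OF that] f that bij_betw_apply[OF f]
    by (cases "u = v") (auto simp: bij_betw_def inj_on_def card_insert_if)
  then show ?thesis
    using f assms(1) unfolding graph_iso_def
    by (intro exI[of _ f]) (auto simp: induced_subgraph_def complete_graph_def Int_absorb1)
qed

lemma induced_empty_iso:
  assumes "A \<subseteq> verts G" "finite A" "card A = m"
    and "\<And>u v. u \<in> A \<Longrightarrow> v \<in> A \<Longrightarrow> {u, v} \<notin> edges G"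
  shows "induced_subgraph G A \<simeq>\<^sub>G empty_graph m"
proof -
  obtain f where f: "bij_betw f A {..<m}"
    using assms(2,3) ex_bij_betw_finite_nat[of A] by (auto simp: atLeast0LessThan)
  then show ?thesis
    using assms(1,4) unfolding graph_iso_def
    by (intro exI[of _ f]) (auto simp: induced_subgraph_def empty_graph_def Int_absorb1)
qed

lemma bij_betw_Plus:
  assumes "bij_betw f A A'" "bij_betw g B B'" "A \<inter> B = {}"
  shows "bij_betw (\<lambda>x. if x \<in> A then Inl (f x) else Inr (g x)) (A \<union> B) (A' <+> B')"
proof -
  let ?h = "\<lambda>x. if x \<in> A then Inl (f x) else Inr (g x)"
  have "bij_betw (Inl \<circ> f) A (Inl ` A')" "bij_betw (Inr \<circ> g) B (Inr ` B')"
    using assms by (auto intro!: bij_betw_trans inj_on_imp_bij_betw)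
  moreover have "a \<notin> A" if "a \<in> B" for a
    using that assms(3) by blast
  ultimately have "bij_betw ?h A (Inl ` A')" "bij_betw ?h B (Inr ` B')"
    using bij_betw_cong[of A ?h "Inl \<circ> f"] bij_betw_cong[of B ?h "Inr \<circ> g"] by auto
  then show ?thesis
    unfolding Plus_def by (rule bij_betw_combine) auto
qed

lemma doubleton_image_iff:
  assumes "inj h"
  shows "{h a, h b} \<in> image h ` E \<longleftrightarrow> {a, b} \<in> E"
  using inj_image_mem_iff[of "image h" "{a, b}" E] assms by (simp add: inj_def inj_image_eq_iff)

lemma Inl_Inr_doubleton_image:
  "{Inl a, Inl b} \<in> image Inl ` E \<longleftrightarrow> {a, b} \<in> E"
  "{Inr c, Inr d} \<in> image Inr ` E' \<longleftrightarrow> {c, d} \<in> E'"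
  "{Inl a, y} \<notin> image Inr ` E'"
  "{y, Inl a} \<notin> image Inr ` E'"
  "{Inr c, y} \<notin> image Inl ` E"
  "{y, Inr c} \<notin> image Inl ` E"
  by (auto simp: doubleton_image_iff)

text \<open>The two isomorphisms are glued along the disjoint parts. The union is recognised inside
  an induced subgraph because in the extremal graph it is one side of a join.\<close>

lemma induced_union_iso:
  assumes G: "A \<union> B \<subseteq> verts G" "A \<inter> B = {}"
    and A: "induced_subgraph G A \<simeq>\<^sub>G H" and B: "induced_subgraph G B \<simeq>\<^sub>G K"
    and cross: "\<And>u v. u \<in> A \<Longrightarrow> v \<in> B \<Longrightarrow> {u, v} \<notin> edges G"
  shows "induced_subgraph G (A \<union> B) \<simeq>\<^sub>G H +\<^sub>G K"
proof -
  have vA: "verts (induced_subgraph G A) = A" "verts (induced_subgraph G B) = B"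
    using G by (auto simp: induced_subgraph_def)
  obtain f where f: "bij_betw f A (verts H)"
    and fe: "\<And>u v. u \<in> A \<Longrightarrow> v \<in> A \<Longrightarrow> {u, v} \<in> edges G \<longleftrightarrow> {f u, f v} \<in> edges H"
    using A unfolding graph_iso_def vA by (auto simp: induced_subgraph_def)
  obtain g where g: "bij_betw g B (verts K)"
    and ge: "\<And>u v. u \<in> B \<Longrightarrow> v \<in> B \<Longrightarrow> {u, v} \<in> edges G \<longleftrightarrow> {g u, g v} \<in> edges K"
    using B unfolding graph_iso_def vA by (auto simp: induced_subgraph_def)
  have cross': "{v, u} \<notin> edges G" if "u \<in> A" "v \<in> B" for u v
    using cross[OF that] by (simp add: insert_commute)
  have notA: "u \<notin> A" if "u \<in> B" for u
    using that G by blast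
  show ?thesis
    unfolding graph_iso_def
    using bij_betw_Plus[OF f g G(2)] G(1)
    by (intro exI[of _ "\<lambda>x. if x \<in> A then Inl (f x) else Inr (g x)"])
      (auto simp: induced_subgraph_def graph_union_def Inl_Inr_doubleton_image Int_absorb1 fe ge cross cross' notA)
qed

lemma join_iso:
  assumes G: "A \<union> B = verts G" "A \<inter> B = {}"
    and A: "induced_subgraph G A \<simeq>\<^sub>G H" and B: "induced_subgraph G B \<simeq>\<^sub>G K"
    and cross: "\<And>u v. u \<in> A \<Longrightarrow> v \<in> B \<Longrightarrow> {u, v} \<in> edges G"
  shows "G \<simeq>\<^sub>G H \<or>\<^sub>G K"
proof -
  have vA: "verts (induced_subgraph G A) = A" "verts (induced_subgraph G B) = B"
    using G by (auto simp: induced_subgraph_def)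
  obtain f where f: "bij_betw f A (verts H)"
    and fe: "\<And>u v. u \<in> A \<Longrightarrow> v \<in> A \<Longrightarrow> {u, v} \<in> edges G \<longleftrightarrow> {f u, f v} \<in> edges H"
    using A unfolding graph_iso_def vA by (auto simp: induced_subgraph_def)
  obtain g where g: "bij_betw g B (verts K)"
    and ge: "\<And>u v. u \<in> B \<Longrightarrow> v \<in> B \<Longrightarrow> {u, v} \<in> edges G \<longleftrightarrow> {g u, g v} \<in> edges K"
    using B unfolding graph_iso_def vA by (auto simp: induced_subgraph_def)
  have cross': "{v, u} \<in> edges G" if "u \<in> A" "v \<in> B" for u v
    using cross[OF that] by (simp add: insert_commute)
  have notA: "u \<notin> A" if "u \<in> B" for u
    using that G by blast
  have fg: "u \<in> A \<Longrightarrow> f u \<in> verts H" "u \<in> B \<Longrightarrow> g u \<in> verts K" for u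
    using bij_betw_apply f g by fast+
  let ?h = "\<lambda>x. if x \<in> A then Inl (f x) else Inr (g x)"
  have "{u, v} \<in> edges G \<longleftrightarrow> {?h u, ?h v} \<in> edges (H \<or>\<^sub>G K)" if "u \<in> A \<union> B" "v \<in> A \<union> B" for u v
  proof -
    consider "u \<in> A" "v \<in> A" | "u \<in> B" "v \<in> B" | "u \<in> A" "v \<in> B" | "u \<in> B" "v \<in> A"
      using \<open>u \<in> A \<union> B\<close> \<open>v \<in> A \<union> B\<close> by blast
    then show ?thesis
      by cases (simp_all add: notA fe ge fg cross cross' graph_join_def graph_union_def
          Inl_Inr_doubleton_image doubleton_eq_iff)
  qed
  then show ?thesis
    using bij_betw_Plus[OF f g G(2)] G(1) unfolding graph_iso_def
    by (intro exI[of _ ?h]) (simp add: graph_join_def graph_union_def)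
qed

text \<open>A one-element independent set is recognised as an empty graph, while the extremal graph
  is written with K_1.\<close>

lemma empty_graph_1: "empty_graph 1 = complete_graph 1"
proof -
  have "card e \<noteq> 2" if "e \<subseteq> {..<1}" for e :: "nat set"
    using card_mono[OF _ that] by auto
  then show ?thesis
    by (auto simp: empty_graph_def complete_graph_def)
qed

text \<open>With F(s) denoting the edge bound, this factors 2F(1) - 2F(s). Doubling clears the
  binomial denominators, and integers are used since the second factor can be negative, as for n = 4
  and s = 2.\<close>

lemma choose_two_plus_square_diff:
  assumes "s \<ge> 1" "2 * s \<le> n"
  shows "2 * (int (((n - s) choose 2) + s ^ 2)) + (int s - 1) * (2 * int n - 3 * int s - 4)
    = 2 * int (((n - 1) choose 2) + 1)"
proof -
  have two: "2 * int (m choose 2) = int m * (int m - 1)" for m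
  proof -
    have "2 * (m choose 2) = m * (m - 1)"
      unfolding choose_two by (rule dvd_mult_div_cancel) auto
    then have "2 * int (m choose 2) = int (m * (m - 1))"
      by (metis of_nat_mult of_nat_numeral)
    then show ?thesis
      by (cases m) (simp_all add: algebra_simps)
  qed
  have "2 * int (((n - s) choose 2) + s ^ 2) = (int n - s) * (int n - s - 1) + 2 * int s ^ 2"
    using two[of "n - s"] assms by (simp add: of_nat_diff algebra_simps)
  moreover have "2 * int (((n - 1) choose 2) + 1) = (int n - 1) * (int n - 2) + 2"
    using two[of "n - 1"] assms by (simp add: of_nat_diff algebra_simps)
  ultimately show ?thesis
    by (simp add: algebra_simps power2_eq_square)
qed

section \<open>The edge bound for a graph with a missing factor\<close>

text \<open>In G itself the independent set may also be adjacent to \<open>v\<close>, so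
  \<open>v\<close> joins its neighbours. The strict inequality in G - v leaves room for this, and
  shrinking the independent set, which keeps the neighbour condition, makes the sizes equal.\<close>

lemma no_factor_imp_balanced_pair:
  assumes "simple_graph G" "v \<in> verts G" "\<not> has_K2_cycle_factor (delete_vertex G v)"
  shows "\<exists>I S. I \<subseteq> verts G \<and> S \<subseteq> verts G - I \<and> card S = card I \<and> I \<noteq> {} \<and>
    (\<forall>x\<in>I. \<forall>y. {x, y} \<in> edges G \<longrightarrow> y \<in> S)"
proof -
  let ?H = "delete_vertex G v"
  have vH: "verts ?H = verts G - {v}" and eH: "edges ?H = {e \<in> edges G. e \<subseteq> verts G - {v}}"
    by (auto simp: delete_vertex_def induced_subgraph_def)
  have fin: "finite (verts G)" and edge: "\<And>e. e \<in> edges G \<Longrightarrow> e \<subseteq> verts G"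
    using assms(1) by (auto simp: simple_graph_def)
  have "simple_graph ?H"
    using assms(1) by (auto simp: simple_graph_def vH eH)
  then obtain J T where J: "J \<subseteq> verts G - {v}" and T: "T \<subseteq> verts G - {v} - J"
    and less: "card T < card J" and nbr: "\<And>x y. x \<in> J \<Longrightarrow> {x, y} \<in> edges ?H \<Longrightarrow> y \<in> T"
    using no_factor_imp_independent_set[OF _ assms(3)] unfolding vH by blast
  have "finite T"
    using T fin by (auto intro: finite_subset)
  then have card_T: "card (insert v T) = Suc (card T)"
    using T by (intro card_insert_disjoint) auto
  then obtain I where I: "I \<subseteq> J" "card I = card (insert v T)"
    using less by (metis Suc_leI obtain_subset_with_card_n)
  have "y \<in> insert v T" if "x \<in> I" "{x, y} \<in> edges G" for x y
  proof (cases "y = v")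
    case False
    then have "{x, y} \<in> edges ?H"
      using that I J edge[OF that(2)] by (auto simp: eH)
    then show ?thesis
      using nbr that(1) I by blast
  qed simp
  moreover have "I \<noteq> {}"
    using I card_T by auto
  moreover have "I \<subseteq> verts G" "insert v T \<subseteq> verts G - I"
    using I J T assms(2) by auto
  ultimately show ?thesis
    using I by (intro exI[of _ I] exI[of _ "insert v T"]) auto
qed

text \<open>Let \<open>W\<close> be the vertices outside \<open>I\<close> and \<open>S\<close>, so
  that n = 2s + |W|. At equality \<open>S\<close> is complete and joined to everything,
  \<open>W\<close> is complete, and \<open>I\<close> is isolated from the rest. The two isomorphisms
  cover the cases needed later: s = 1, and |W| at most 1.\<close>

lemma no_factor_size_bound:
  assumes "simple_graph G" "v \<in> verts G" "\<not> has_K2_cycle_factor (delete_vertex G v)"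
    and n: "graph_order G = n"
  obtains s where "s \<ge> 1" "2 * s \<le> n" "graph_size G \<le> ((n - s) choose 2) + s ^ 2"
    and "graph_size G = ((n - s) choose 2) + s ^ 2 \<Longrightarrow> s = 1 \<Longrightarrow>
      G \<simeq>\<^sub>G complete_graph 1 \<or>\<^sub>G (complete_graph (n - 2) +\<^sub>G complete_graph 1)"
    and "graph_size G = ((n - s) choose 2) + s ^ 2 \<Longrightarrow> n \<le> 2 * s + 1 \<Longrightarrow>
      G \<simeq>\<^sub>G complete_graph s \<or>\<^sub>G empty_graph (n - s)"
proof -
  obtain I S where I: "I \<subseteq> verts G" "I \<noteq> {}" and S: "S \<subseteq> verts G - I" "card S = card I"
    and nbr: "\<forall>x\<in>I. \<forall>y. {x, y} \<in> edges G \<longrightarrow> y \<in> S"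
    using no_factor_imp_balanced_pair[OF assms(1-3)] by blast
  define s where "s = card I"
  define W where "W = verts G - S - I"
  have fin: "finite (verts G)"
    using assms(1) by (simp add: simple_graph_def)
  then have finIS: "finite I" "finite S" "finite W"
    using I S by (auto simp: W_def intro: finite_subset)
  have s: "card I = s" "card S = s"
    using S by (simp_all add: s_def)
  note bound = independent_set_edges[OF assms(1) I(1) S(1) s nbr, unfolded n]
  have "n = card (S \<union> I \<union> W)"
    using I S n by (auto simp: graph_order_def W_def intro: arg_cong[of _ _ card])
  also have "\<dots> = s + s + card W"
  proof -
    have "card (S \<union> I) = s + s"
      using finIS S(1) s by (subst card_Un_disjoint) auto
    then show ?thesis
      using finIS by (subst card_Un_disjoint) (auto simp: W_def)
  qed
  finally have n_eq: "n = 2 * s + card W" by simp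
  have complete_S: "induced_subgraph G S \<simeq>\<^sub>G complete_graph s"
    if "graph_size G = ((n - s) choose 2) + s ^ 2"
    using bound(2)[OF that] S finIS s by (intro induced_complete_iso) auto
  show thesis
  proof (rule that[of s])
    show "s \<ge> 1"
      using I finIS by (simp add: s_def Suc_le_eq card_gt_0_iff)
    show "2 * s \<le> n" using n_eq by simp
    show "graph_size G \<le> ((n - s) choose 2) + s ^ 2"
      by (rule bound(1))
  next
    assume eq: "graph_size G = ((n - s) choose 2) + s ^ 2" and "s = 1"
    note adj = bound(2)[OF eq]
    have "induced_subgraph G (W \<union> I) \<simeq>\<^sub>G complete_graph (n - 2) +\<^sub>G complete_graph 1"
    proof (rule induced_union_iso)
      show "induced_subgraph G W \<simeq>\<^sub>G complete_graph (n - 2)"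
        using adj n_eq finIS \<open>s = 1\<close> by (intro induced_complete_iso) (auto simp: W_def)
      have "induced_subgraph G I \<simeq>\<^sub>G empty_graph 1"
        using adj I S finIS s \<open>s = 1\<close> by (intro induced_empty_iso) auto
      then show "induced_subgraph G I \<simeq>\<^sub>G complete_graph 1"
        by (simp only: empty_graph_1)
      show "{u, w} \<notin> edges G" if "u \<in> W" "w \<in> I" for u w
        using adj[of u w] that I by (auto simp: W_def)
    qed (use I in \<open>auto simp: W_def\<close>)
    then show "G \<simeq>\<^sub>G complete_graph 1 \<or>\<^sub>G (complete_graph (n - 2) +\<^sub>G complete_graph 1)"
      using adj I S complete_S[OF eq] \<open>s = 1\<close>
      by (intro join_iso[of S "W \<union> I"]) (auto simp: W_def)
  next
    assume eq: "graph_size G = ((n - s) choose 2) + s ^ 2" and "n \<le> 2 * s + 1"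
    note adj = bound(2)[OF eq]
    \<comment> \<open>A complete graph on at most one vertex has no edges, so \<open>W\<close>
      merges with \<open>I\<close> into one independent set.\<close>
    have "card W \<le> 1"
      using n_eq \<open>n \<le> 2 * s + 1\<close> by simp
    then have W: "u = w" if "u \<in> W" "w \<in> W" for u w
      using that finIS by (auto simp: card_le_Suc0_iff_eq)
    have "induced_subgraph G (verts G - S) \<simeq>\<^sub>G empty_graph (n - s)"
    proof (rule induced_empty_iso)
      show "card (verts G - S) = n - s"
        using n s S finIS by (subst card_Diff_subset) (auto simp: graph_order_def)
      show "{u, w} \<notin> edges G" if "u \<in> verts G - S" "w \<in> verts G - S" for u w
        using adj[of u w] W[of u w] that by (auto simp: W_def)
    qed (use fin in auto)
    then show "G \<simeq>\<^sub>G complete_graph s \<or>\<^sub>G empty_graph (n - s)"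
      using adj S complete_S[OF eq]
      by (intro join_iso[of S "verts G - S"]) auto
  qed
qed

section \<open>Comparing the bound with the required numbers of edges\<close>

text \<open>If s > 1, the factor 2n - 3s - 4 is positive, so the bound at s lies strictly below the
  bound at 1. For n at least 9 this follows from s \<le> n/2; for n = 7 integrality gives s \<le> 3
  and the factor is at least 1; for n = 3 only s = 1 is possible.\<close>

lemma size_bound_eq_one:
  fixes n s :: nat
  assumes "n \<ge> 9 \<or> n = 3 \<or> n = 7" "s \<ge> 1" "2 * s \<le> n"
    and "((n - 1) choose 2) + 1 \<le> ((n - s) choose 2) + s ^ 2"
  shows "s = 1"
proof (rule ccontr)
  assume "s \<noteq> 1"
  then have "int s - 1 > 0" "2 * int n - 3 * int s - 4 > 0"
    using assms(1-3) by presburger+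
  then have "(int s - 1) * (2 * int n - 3 * int s - 4) > 0"
    by simp
  then have "int (((n - s) choose 2) + s ^ 2) < int (((n - 1) choose 2) + 1)"
    using choose_two_plus_square_diff[OF assms(2,3)]
    by (metis less_add_same_cancel1 mult_less_cancel_left_pos zero_less_numeral)
  then show False
    using assms(4) by (simp only: of_nat_less_iff)
qed

theorem corollary6p4:
  fixes G :: "'a graph" and n :: nat
  assumes "n \<ge> 3"
    and "simple_graph G"
    and "connected_graph G"
    and "graph_order G = n"
  shows
    "((n \<ge> 9 \<or> n = 3 \<or> n = 7) \<and>
      graph_size G \<ge> ((n - 1) choose 2) + 1 \<and>
      \<not> G \<simeq>\<^sub>G complete_graph 1 \<or>\<^sub>G (complete_graph (n - 2) +\<^sub>G complete_graph 1)
        \<longrightarrow> (\<forall>v\<in>verts G. has_K2_cycle_factor (delete_vertex G v)))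
     \<and>
     (n \<in> {4, 6} \<and>
      real (graph_size G) \<ge> (3 * real n ^ 2 - 2 * real n) / 8 \<and>
      \<not> G \<simeq>\<^sub>G complete_graph (n div 2) \<or>\<^sub>G empty_graph (n div 2)
        \<longrightarrow> (\<forall>v\<in>verts G. has_K2_cycle_factor (delete_vertex G v)))
     \<and>
     (n = 5 \<and> graph_size G \<ge> 7 \<and>
      \<not> (G \<simeq>\<^sub>G complete_graph 2 \<or>\<^sub>G empty_graph 3 \<or>
         G \<simeq>\<^sub>G complete_graph 1 \<or>\<^sub>G (complete_graph 3 +\<^sub>G complete_graph 1))
        \<longrightarrow> (\<forall>v\<in>verts G. has_K2_cycle_factor (delete_vertex G v)))
     \<and>
     (n = 8 \<and> graph_size G \<ge> 22 \<and>
      \<not> (G \<simeq>\<^sub>G complete_graph 4 \<or>\<^sub>G empty_graph 4 \<or>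
         G \<simeq>\<^sub>G complete_graph 1 \<or>\<^sub>G (complete_graph 6 +\<^sub>G complete_graph 1))
        \<longrightarrow> (\<forall>v\<in>verts G. has_K2_cycle_factor (delete_vertex G v)))"
proof -
  let ?star = "complete_graph 1 \<or>\<^sub>G (complete_graph (n - 2) +\<^sub>G complete_graph 1)"
  \<comment> \<open>Contrapositive form of the size bound: a factor exists once every candidate
    \<open>s\<close>, with its equality cases, has been refuted.\<close>
  have factor: "has_K2_cycle_factor (delete_vertex G v)"
    if v: "v \<in> verts G"
      and contra: "\<And>s. s \<ge> 1 \<Longrightarrow> 2 * s \<le> n \<Longrightarrow> graph_size G \<le> ((n - s) choose 2) + s ^ 2 \<Longrightarrow>
        (graph_size G = ((n - s) choose 2) + s ^ 2 \<Longrightarrow> s = 1 \<Longrightarrow> G \<simeq>\<^sub>G ?star) \<Longrightarrow>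
        (graph_size G = ((n - s) choose 2) + s ^ 2 \<Longrightarrow> n \<le> 2 * s + 1 \<Longrightarrow>
          G \<simeq>\<^sub>G complete_graph s \<or>\<^sub>G empty_graph (n - s)) \<Longrightarrow> False" for v
    using no_factor_size_bound[OF assms(2) v _ assms(4)] contra by metis
  show ?thesis
  proof (intro conjI impI ballI)
    fix v
    assume "(n \<ge> 9 \<or> n = 3 \<or> n = 7) \<and> graph_size G \<ge> ((n - 1) choose 2) + 1 \<and> \<not> G \<simeq>\<^sub>G ?star"
      and v: "v \<in> verts G"
    then have h: "n \<ge> 9 \<or> n = 3 \<or> n = 7" "graph_size G \<ge> ((n - 1) choose 2) + 1" "\<not> G \<simeq>\<^sub>G ?star"
      by blast+
    show "has_K2_cycle_factor (delete_vertex G v)"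
    proof (rule factor[OF v])
      fix s :: nat
      assume s: "s \<ge> 1" "2 * s \<le> n" "graph_size G \<le> ((n - s) choose 2) + s ^ 2"
        and iso: "graph_size G = ((n - s) choose 2) + s ^ 2 \<Longrightarrow> s = 1 \<Longrightarrow> G \<simeq>\<^sub>G ?star"
      have "s = 1"
        using size_bound_eq_one[OF h(1) s(1,2)] h(2) s(3) by linarith
      then show False
        using iso h s by simp
    qed
  next
    fix v
    assume h: "n \<in> {4, 6} \<and> real (graph_size G) \<ge> (3 * real n ^ 2 - 2 * real n) / 8 \<and>
        \<not> G \<simeq>\<^sub>G complete_graph (n div 2) \<or>\<^sub>G empty_graph (n div 2)"
      and v: "v \<in> verts G"
    \<comment> \<open>The threshold evaluates to 5 and 12, which is the bound at s = n/2.\<close>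
    then have size: "n = 4 \<and> graph_size G \<ge> 5 \<or> n = 6 \<and> graph_size G \<ge> 12"
      by auto
    show "has_K2_cycle_factor (delete_vertex G v)"
    proof (rule factor[OF v])
      fix s :: nat
      assume s: "s \<ge> 1" "2 * s \<le> n" "graph_size G \<le> ((n - s) choose 2) + s ^ 2"
        and iso: "graph_size G = ((n - s) choose 2) + s ^ 2 \<Longrightarrow> n \<le> 2 * s + 1 \<Longrightarrow>
          G \<simeq>\<^sub>G complete_graph s \<or>\<^sub>G empty_graph (n - s)"
      \<comment> \<open>For n = 4 the bounds at s = 1, 2 are 4, 5; for n = 6 those at s = 1, 2, 3
        are 11, 10, 12. Only s = n/2 reaches the threshold, and then with equality.\<close>
      have "s = 1 \<or> s = 2 \<or> s = 3"
        using s size by auto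
      then show False
        using s size iso h by (auto simp: choose_two)
    qed
  next
    fix v
    assume h: "n = 5 \<and> graph_size G \<ge> 7 \<and>
        \<not> (G \<simeq>\<^sub>G complete_graph 2 \<or>\<^sub>G empty_graph 3 \<or>
           G \<simeq>\<^sub>G complete_graph 1 \<or>\<^sub>G (complete_graph 3 +\<^sub>G complete_graph 1))"
      and v: "v \<in> verts G"
    show "has_K2_cycle_factor (delete_vertex G v)"
    proof (rule factor[OF v])
      fix s :: nat
      assume s: "s \<ge> 1" "2 * s \<le> n" "graph_size G \<le> ((n - s) choose 2) + s ^ 2"
        and iso: "graph_size G = ((n - s) choose 2) + s ^ 2 \<Longrightarrow> s = 1 \<Longrightarrow> G \<simeq>\<^sub>G ?star"
          "graph_size G = ((n - s) choose 2) + s ^ 2 \<Longrightarrow> n \<le> 2 * s + 1 \<Longrightarrow>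
          G \<simeq>\<^sub>G complete_graph s \<or>\<^sub>G empty_graph (n - s)"
      \<comment> \<open>Both values of \<open>s\<close> give the bound 7, hence equality and two
        exceptional graphs.\<close>
      have "s = 1 \<or> s = 2"
        using s h by auto
      then show False
        using s iso h by (auto simp: choose_two)
    qed
  next
    fix v
    assume h: "n = 8 \<and> graph_size G \<ge> 22 \<and>
        \<not> (G \<simeq>\<^sub>G complete_graph 4 \<or>\<^sub>G empty_graph 4 \<or>
           G \<simeq>\<^sub>G complete_graph 1 \<or>\<^sub>G (complete_graph 6 +\<^sub>G complete_graph 1))"
      and v: "v \<in> verts G"
    show "has_K2_cycle_factor (delete_vertex G v)"
    proof (rule factor[OF v])
      fix s :: nat
      assume s: "s \<ge> 1" "2 * s \<le> n" "graph_size G \<le> ((n - s) choose 2) + s ^ 2"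
        and iso: "graph_size G = ((n - s) choose 2) + s ^ 2 \<Longrightarrow> s = 1 \<Longrightarrow> G \<simeq>\<^sub>G ?star"
          "graph_size G = ((n - s) choose 2) + s ^ 2 \<Longrightarrow> n \<le> 2 * s + 1 \<Longrightarrow>
          G \<simeq>\<^sub>G complete_graph s \<or>\<^sub>G empty_graph (n - s)"
      \<comment> \<open>The bounds are 22, 19, 19, 22: only the two ends survive, each with
        equality.\<close>
      have "s = 1 \<or> s = 2 \<or> s = 3 \<or> s = 4"
        using s h by auto
      then show False
        using s iso h by (auto simp: choose_two)
    qed
  qed
qed

end
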